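(* Let $Q\subset\mathbb{R}^m$ be closed, let $\varphi:\mathbb{R}^n\to\mathbb{R}^m$ be continuous, and set $C:=\varphi^{-1}(Q)$. Let $\bar x\in C$ and $h\in\mathbb{R}^n$, and assume that the set-valued mapping $F:\mathbb{R}^n\rightrightarrows\mathbb{R}^m$, $F(x)=Q-\varphi(x)$, is metrically subregular at $(\bar x,0)$ in direction $h$. Then $$N_C(\bar x;h)\subset\Big(\bigcup_{v\in D\varphi(\bar x)(h)\cap T_Q(\varphi(\bar x))}D^*\varphi(\bar x;(h,v))\,N_Q(\varphi(\bar x);v)\Big)\cup\Big(\bigcup_{v\in D\varphi(\bar x)(0)\cap\mathbb{S}\cap T_Q(\varphi(\bar x))}D^*\varphi(\bar x;(0,v))\,N_Q(\varphi(\bar x);v)\Big).$$ Moreover, if $\varphi$ is calm at $\bar x$ in direction $h$, then $$N_C(\bar x;h)\subset\bigcup_{v\in D\varphi(\bar x)(h)\cap T_Q(\varphi(\bar x))}D^*\varphi(\bar x;(h,v))\,N_Q(\varphi(\bar x);v).$$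
   Context: Euclidean norms are used; $\mathbb{S}$ is the unit sphere and $\mathbb{B}$ the closed unit ball; $t_k\downarrow0$ means $t_k>0$, $t_k\to0$; $d_A(x)$ is the distance from $x$ to a set $A$. For $\Omega\subset\mathbb{R}^n$ and $x\in\Omega$: the tangent (contingent) cone is $T_\Omega(x)=\{u\mid\exists u_k\to u,\ t_k\downarrow0:\ x+t_ku_k\in\Omega\ \forall k\}$; the regular normal cone is $\hat N_\Omega(x)=\{\xi\mid\limsup_{x'\to x,\,x'\in\Omega}\langle\xi,x'-x\rangle/\|x'-x\|\le0\}$. Both are empty if $x\notin\Omega$. The limiting normal cone to $\Omega$ at $x$ in direction $u\in\mathbb{R}^n$ is $$N_\Omega(x;u)=\{\xi\mid\exists t_k\downarrow0,\ u_k\to u,\ \xi_k\to\xi:\ \xi_k\in\hat N_\Omega(x+t_ku_k)\ \forall k\}.$$ For a single-valued $\varphi:\mathbb{R}^n\to\mathbb{R}^m$ with graph $\mathrm{gph}\,\varphi$: the graphical derivative is $D\varphi(x)(u)=\{v\mid(u,v)\in T_{\mathrm{gph}\,\varphi}(x,\varphi(x))\}$, and the directional limiting coderivative is $D^*\varphi(x;(u,v))(\eta)=\{\xi\mid(\xi,-\eta)\in N_{\mathrm{gph}\,\varphi}((x,\varphi(x));(u,v))\}$. For a set $A$, $D^*\varphi(x;(u,v))A:=\bigcup_{\eta\in A}D^*\varphi(x;(u,v))(\eta)$. A directional neighborhood of $u\in\mathbb{R}^n$ is a set containing $\mathcal{V}_{\rho,\delta}(u):=\{z\in\rho\mathbb{B}\mid\big\|\|u\|z-\|z\|u\big\|\le\delta\|z\|\|u\|\}$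 for some $\rho,\delta>0$. A multifunction $F$ is metrically subregular at $(\bar x,\bar y)\in\mathrm{gph}\,F$ in direction $u$ if there are $\kappa>0$ and a directional neighborhood $\mathcal{U}$ of $u$ with $d_{F^{-1}(\bar y)}(x)\le\kappa\,d_{F(x)}(\bar y)$ for all $x\in\bar x+\mathcal{U}$ (with $d_\emptyset=\infty$). $\varphi$ is calm at $\bar x$ in direction $u$ if there are $\kappa>0$ and a directional neighborhood $\mathcal{U}$ of $u$ with $\|\varphi(x)-\varphi(\bar x)\|\le\kappa\|x-\bar x\|$ for all $x\in\bar x+\mathcal{U}$. *)

theory Defs
  imports "HOL-Analysis.Analysis"
begin

definition seq_down_zero :: "(nat \<Rightarrow> real) \<Rightarrow> bool" where
  "seq_down_zero t \<longleftrightarrow> (\<forall>k. t k > 0) \<and> t \<longlonglongrightarrow> 0"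

text \<open>The distance to a set is extended-real valued so that the distance to the empty set is
  infinite, as an infimum over the empty set (\<^const>\<open>infdist\<close> would give 0).\<close>

definition edist_set :: "'a::metric_space set \<Rightarrow> 'a \<Rightarrow> ereal" where
  "edist_set A x = (INF a\<in>A. ereal (dist x a))"

definition tangent_cone :: "'a::real_normed_vector set \<Rightarrow> 'a \<Rightarrow> 'a set" where
  "tangent_cone \<Omega> x = {u. x \<in> \<Omega> \<and>
     (\<exists>us t. us \<longlonglongrightarrow> u \<and> seq_down_zero t \<and> (\<forall>k. x + t k *\<^sub>R us k \<in> \<Omega>))}"

text \<open>At an isolated point of \<open>\<Omega>\<close> the filter below is trivial, the upper limit is
  \<open>- \<infinity>\<close>, and the cone is the whole space.\<close>

definition regular_normal_cone :: "'a::real_inner set \<Rightarrow> 'a \<Rightarrow> 'a set" where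
  "regular_normal_cone \<Omega> x = {\<xi>. x \<in> \<Omega> \<and>
     Limsup (at x within \<Omega>) (\<lambda>x'. ereal (\<xi> \<bullet> (x' - x) / norm (x' - x))) \<le> 0}"

definition dir_normal_cone :: "'a::real_inner set \<Rightarrow> 'a \<Rightarrow> 'a \<Rightarrow> 'a set" where
  "dir_normal_cone \<Omega> x u = {\<xi>. \<exists>t us \<xi>s. seq_down_zero t \<and> us \<longlonglongrightarrow> u \<and> \<xi>s \<longlonglongrightarrow> \<xi> \<and>
     (\<forall>k. \<xi>s k \<in> regular_normal_cone \<Omega> (x + t k *\<^sub>R us k))}"

definition gph :: "('a \<Rightarrow> 'b) \<Rightarrow> ('a \<times> 'b) set" where
  "gph \<phi> = {(x, y). y = \<phi> x}"

definition graphical_derivative ::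
  "('a::real_normed_vector \<Rightarrow> 'b::real_normed_vector) \<Rightarrow> 'a \<Rightarrow> 'a \<Rightarrow> 'b set" where
  "graphical_derivative \<phi> x u = {v. (u, v) \<in> tangent_cone (gph \<phi>) (x, \<phi> x)}"

definition dir_coderivative ::
  "('a::real_inner \<Rightarrow> 'b::real_inner) \<Rightarrow> 'a \<Rightarrow> 'a \<times> 'b \<Rightarrow> 'b \<Rightarrow> 'a set" where
  "dir_coderivative \<phi> x uv \<eta> = {\<xi>. (\<xi>, - \<eta>) \<in> dir_normal_cone (gph \<phi>) (x, \<phi> x) uv}"

definition dir_coderivative_image ::
  "('a::real_inner \<Rightarrow> 'b::real_inner) \<Rightarrow> 'a \<Rightarrow> 'a \<times> 'b \<Rightarrow> 'b set \<Rightarrow> 'a set" where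
  "dir_coderivative_image \<phi> x uv A = (\<Union>\<eta>\<in>A. dir_coderivative \<phi> x uv \<eta>)"

definition basic_dir_nbhd :: "real \<Rightarrow> real \<Rightarrow> 'a::real_normed_vector \<Rightarrow> 'a set" where
  "basic_dir_nbhd \<rho> \<delta> u =
     {z \<in> cball 0 \<rho>. norm (norm u *\<^sub>R z - norm z *\<^sub>R u) \<le> \<delta> * norm z * norm u}"

definition dir_nbhd :: "'a::real_normed_vector \<Rightarrow> 'a set \<Rightarrow> bool" where
  "dir_nbhd u U \<longleftrightarrow> (\<exists>\<rho>>0. \<exists>\<delta>>0. basic_dir_nbhd \<rho> \<delta> u \<subseteq> U)"

text \<open>A multifunction is a set-valued function; its inverse at \<open>y\<close> is \<open>{x. y \<in> F x}\<close>, and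
  \<open>y \<in> F x\<close> says that \<open>(x, y)\<close> lies in its graph.\<close>

definition metrically_subregular_dir ::
  "('a::real_normed_vector \<Rightarrow> 'b::real_normed_vector set) \<Rightarrow> 'a \<Rightarrow> 'b \<Rightarrow> 'a \<Rightarrow> bool" where
  "metrically_subregular_dir F xbar ybar u \<longleftrightarrow> ybar \<in> F xbar \<and>
     (\<exists>\<kappa>::real. \<kappa> > 0 \<and> (\<exists>U. dir_nbhd u U \<and>
       (\<forall>x \<in> (+) xbar ` U. edist_set {x'. ybar \<in> F x'} x \<le> ereal \<kappa> * edist_set (F x) ybar)))"

definition calm_dir ::
  "('a::real_normed_vector \<Rightarrow> 'b::real_normed_vector) \<Rightarrow> 'a \<Rightarrow> 'a \<Rightarrow> bool" where
  "calm_dir \<phi> xbar u \<longleftrightarrow>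
     (\<exists>\<kappa>::real. \<kappa> > 0 \<and> (\<exists>U. dir_nbhd u U \<and>
       (\<forall>x \<in> (+) xbar ` U. norm (\<phi> x - \<phi> xbar) \<le> \<kappa> * norm (x - xbar))))"

end

theory Submission
  imports Defs
begin

text \<open>Write \<open>C = \<phi> -` Q\<close> and let \<open>\<xi>\<close> be a normal to \<open>C\<close> at \<open>xbar\<close> in direction \<open>h\<close>, that is, a limit
  of regular normals to \<open>C\<close> at points \<open>xbar + t\<^sub>k h\<^sub>k\<close> with \<open>h\<^sub>k \<longlonglongrightarrow> h\<close> and \<open>t\<^sub>k > 0\<close> tending to zero. The proof
  has two parts: an approximate multiplier rule at each of these points, and a passage to the limit
  at the right scale.

  \<^emph>\<open>Multipliers.\<close> A regular normal \<open>\<xi>\<close> to \<open>C\<close> at \<open>x\<close> says that \<open>y \<mapsto> \<epsilon> dist y x - \<xi> \<bullet> (y - x)\<close> is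
  locally minimal on \<open>C\<close> at \<open>x\<close> for every \<open>\<epsilon> > 0\<close>. This function is Lipschitz, so the constraint \<open>y \<in> C\<close> may be
  replaced by a multiple of the distance to \<open>C\<close> (\<open>exact_penalty\<close>), and subregularity bounds that
  distance by \<open>\<kappa> dist (\<phi> y) q\<close> for every \<open>q \<in> Q\<close>. What remains is a minimization over pairs
  \<open>(y, q)\<close> whose two parts are coupled only through the norm of \<open>\<phi> y - q\<close>. Since \<open>\<phi>\<close> is merely
  continuous, no chain rule is available; instead every norm is replaced by the smooth function
  \<open>soft_norm s\<close>. A nearby minimizer of the smoothed problem exists by compactness, and
  minimality in each variable separately gives a regular normal \<open>(\<xi>', - \<eta>)\<close> to the graph of \<open>\<phi>\<close> and a
  regular normal \<open>\<eta>\<close> to \<open>Q\<close>, with the same \<open>\<eta>\<close> because both come from the gradient of the coupling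
  term (\<open>approximate_multiplier\<close>). The gradient of a smoothed norm has length at most one, so \<open>\<eta>\<close> is
  bounded in terms of \<open>\<kappa>\<close> and \<open>\<xi>\<close> only.

  \<^emph>\<open>Limits.\<close> Applying this with precision \<open>t\<^sub>k\<^sup>2\<close> gives points \<open>x\<^sub>k\<close> and \<open>q\<^sub>k\<close> with
  \<open>(x\<^sub>k - xbar) / t\<^sub>k \<longlonglongrightarrow> h\<close> and \<open>(q\<^sub>k - \<phi> x\<^sub>k) / t\<^sub>k \<longlonglongrightarrow> 0\<close>, and bounded multipliers
  (\<open>subregular_multiplier_sequences\<close>). Put \<open>w\<^sub>k = \<phi> x\<^sub>k - \<phi> xbar\<close>. If \<open>w\<^sub>k / t\<^sub>k\<close> is bounded along a
  subsequence, a cluster point \<open>v\<close> of it is the direction in the first union. Otherwise the norm of \<open>w\<^sub>k\<close>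
  is eventually much larger than \<open>t\<^sub>k\<close>; rescaling by that norm instead of \<open>t\<^sub>k\<close> turns the direction
  \<open>h\<close> into \<open>0\<close> and makes \<open>v\<close> a unit vector, which is the second union. Both cases are
  \<open>rescaled_multiplier_limit\<close>. Calmness in direction \<open>h\<close> excludes the second case.\<close>

section \<open>Regular normals\<close>

lemma mem_regular_normal_cone_iff:
  "\<xi> \<in> regular_normal_cone \<Omega> x \<longleftrightarrow>
     x \<in> \<Omega> \<and> (\<forall>\<epsilon>>0. \<exists>\<delta>>0. \<forall>y\<in>\<Omega>. dist y x < \<delta> \<longrightarrow> \<xi> \<bullet> (y - x) \<le> \<epsilon> * dist y x)"
    (is "_ \<longleftrightarrow> _ \<and> ?R")
proof -
  let ?g = "\<lambda>y. \<xi> \<bullet> (y - x) / norm (y - x)"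
  have "Limsup (at x within \<Omega>) (\<lambda>y. ereal (?g y)) \<le> 0 \<longleftrightarrow>
        (\<forall>e>0. \<forall>\<^sub>F y in at x within \<Omega>. ?g y < e)"
  proof
    assume *: "Limsup (at x within \<Omega>) (\<lambda>y. ereal (?g y)) \<le> 0"
    show "\<forall>e>0. \<forall>\<^sub>F y in at x within \<Omega>. ?g y < e"
    proof (intro allI impI)
      fix e :: real assume "e > 0"
      then have "Limsup (at x within \<Omega>) (\<lambda>y. ereal (?g y)) < ereal e"
        using * by (simp add: le_less_trans)
      from Limsup_lessD[OF this] show "\<forall>\<^sub>F y in at x within \<Omega>. ?g y < e" by simp
    qed
  next
    assume *: "\<forall>e>0. \<forall>\<^sub>F y in at x within \<Omega>. ?g y < e"
    show "Limsup (at x within \<Omega>) (\<lambda>y. ereal (?g y)) \<le> 0"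
      unfolding Limsup_le_iff
    proof (intro allI impI)
      fix e :: ereal assume "e > 0"
      then obtain e' :: real where e': "0 < ereal e'" "ereal e' < e"
        using ereal_dense2 by blast
      then have "\<forall>\<^sub>F y in at x within \<Omega>. ?g y < e'" using * by simp
      then show "\<forall>\<^sub>F y in at x within \<Omega>. ereal (?g y) < e"
      proof (rule eventually_mono)
        fix y assume "?g y < e'"
        then have "ereal (?g y) < ereal e'" by simp
        then show "ereal (?g y) < e" using e'(2) by (rule less_trans)
      qed
    qed
  qed
  also have "\<dots> \<longleftrightarrow> ?R"
  proof
    assume L: "\<forall>e>0. \<forall>\<^sub>F y in at x within \<Omega>. ?g y < e"
    show ?R
    proof (intro allI impI)
      fix e :: real assume "e > 0"
      with L obtain d where d: "d > 0" "\<And>y. \<lbrakk>y \<in> \<Omega>; y \<noteq> x; dist y x < d\<rbrakk> \<Longrightarrow> ?g y < e"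
        unfolding eventually_at by blast
      have "\<xi> \<bullet> (y - x) \<le> e * dist y x" if "y \<in> \<Omega>" "dist y x < d" for y
        using d(2)[OF that(1) _ that(2)]
        by (cases "y = x") (auto simp: dist_norm pos_divide_less_eq)
      with d(1) show "\<exists>\<delta>>0. \<forall>y\<in>\<Omega>. dist y x < \<delta> \<longrightarrow> \<xi> \<bullet> (y - x) \<le> e * dist y x"
        by blast
    qed
  next
    assume R: ?R
    show "\<forall>e>0. \<forall>\<^sub>F y in at x within \<Omega>. ?g y < e"
    proof (intro allI impI)
      fix e :: real assume "e > 0"
      then have "e / 2 > 0" by simp
      with R obtain d where d: "d > 0"
        "\<And>y. \<lbrakk>y \<in> \<Omega>; dist y x < d\<rbrakk> \<Longrightarrow> \<xi> \<bullet> (y - x) \<le> e / 2 * dist y x"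
        by meson
      have "?g y < e" if "y \<in> \<Omega>" "y \<noteq> x" "dist y x < d" for y
      proof -
        have "?g y \<le> e / 2"
          using d(2)[OF that(1,3)] that(2) by (simp add: dist_norm pos_divide_le_eq)
        with \<open>e > 0\<close> show ?thesis by linarith
      qed
      with d(1) show "\<forall>\<^sub>F y in at x within \<Omega>. ?g y < e"
        unfolding eventually_at by blast
    qed
  qed
  finally show ?thesis by (simp add: regular_normal_cone_def)
qed

text \<open>Since a quadratic error is negligible against \<open>\<epsilon> dist y x\<close> near \<open>x\<close>, proximal normals are regular
  normals. It is in this form that regular normals arise from minimality of smooth functions.\<close>

lemma regular_normal_coneI_quadratic:
  assumes "x \<in> \<Omega>" "r > 0"
    and bound: "\<And>y. \<lbrakk>y \<in> \<Omega>; dist y x < r\<rbrakk> \<Longrightarrow> \<xi> \<bullet> (y - x) \<le> c * (norm (y - x))\<^sup>2"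
  shows "\<xi> \<in> regular_normal_cone \<Omega> x"
  unfolding mem_regular_normal_cone_iff
proof (intro conjI allI impI)
  fix \<epsilon> :: real assume "\<epsilon> > 0"
  define \<delta> where "\<delta> = min r (\<epsilon> / (\<bar>c\<bar> + 1))"
  have "\<xi> \<bullet> (y - x) \<le> \<epsilon> * dist y x" if y: "y \<in> \<Omega>" "dist y x < \<delta>" for y
  proof -
    have n: "norm (y - x) < \<epsilon> / (\<bar>c\<bar> + 1)" "dist y x < r"
      using y(2) by (auto simp: \<delta>_def dist_norm)
    have "c * norm (y - x) \<le> (\<bar>c\<bar> + 1) * norm (y - x)"
      by (intro mult_right_mono) auto
    also have "\<dots> \<le> \<epsilon>"
      using n(1) by (simp add: pos_less_divide_eq mult.commute)
    finally have "c * norm (y - x) * norm (y - x) \<le> \<epsilon> * norm (y - x)"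
      by (intro mult_right_mono) auto
    with bound[OF y(1) n(2)] show ?thesis
      by (simp add: power2_eq_square dist_norm mult.assoc)
  qed
  moreover have "\<delta> > 0" using \<open>r > 0\<close> \<open>\<epsilon> > 0\<close> by (simp add: \<delta>_def)
  ultimately show "\<exists>\<delta>>0. \<forall>y\<in>\<Omega>. dist y x < \<delta> \<longrightarrow> \<xi> \<bullet> (y - x) \<le> \<epsilon> * dist y x" by blast
qed fact

section \<open>A smoothed norm\<close>

definition soft_norm :: "real \<Rightarrow> 'a::real_inner \<Rightarrow> real" where
  "soft_norm s z = sqrt ((norm z)\<^sup>2 + s\<^sup>2)"

lemma norm_le_soft_norm: "norm z \<le> soft_norm s z"
  unfolding soft_norm_def by (rule real_le_rsqrt) simp

lemma soft_norm_zero: "s > 0 \<Longrightarrow> soft_norm s 0 = s"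
  by (simp add: soft_norm_def)

lemma soft_norm_pos: "s > 0 \<Longrightarrow> soft_norm s z > 0"
  unfolding soft_norm_def by (simp add: add_nonneg_pos)

lemma continuous_on_soft_norm [continuous_intros]:
  "continuous_on S f \<Longrightarrow> continuous_on S (\<lambda>x. soft_norm s (f x))"
  unfolding soft_norm_def by (intro continuous_intros)

lemma norm_scaled_by_soft_norm_le:
  assumes "s > 0" "c \<ge> 0"
  shows "norm ((c / soft_norm s z) *\<^sub>R z) \<le> c"
proof -
  have "norm z / soft_norm s z \<le> 1"
    using norm_le_soft_norm[of z s] soft_norm_pos[OF assms(1), of z] by simp
  from mult_left_mono[OF this assms(2)] show ?thesis
    using soft_norm_pos[OF assms(1), of z] assms(2) by simp
qed

text \<open>The linear term is the derivative of \<open>soft_norm s\<close> at \<open>z\<close>. With \<open>A\<close> and \<open>B\<close> the values at \<open>z\<close> and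
  \<open>z + w\<close>, the bound is \<open>2 A B \<le> A\<^sup>2 + B\<^sup>2\<close> divided by \<open>2 A\<close>. A minimizer of a sum of
  smoothed norms and linear functions thus satisfies a first-order condition with quadratic error.\<close>

lemma soft_norm_quadratic_upper_bound:
  assumes "s > 0"
  shows "soft_norm s (z + w) \<le>
           soft_norm s z + (z \<bullet> w) / soft_norm s z + (norm w)\<^sup>2 / (2 * soft_norm s z)"
proof -
  define A where "A = soft_norm s z"
  define B where "B = soft_norm s (z + w)"
  have A: "A > 0" using soft_norm_pos[OF assms] by (simp add: A_def)
  have A2: "A\<^sup>2 = (norm z)\<^sup>2 + s\<^sup>2" and B2: "B\<^sup>2 = (norm (z + w))\<^sup>2 + s\<^sup>2"
    by (simp_all add: A_def B_def soft_norm_def)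
  have "B\<^sup>2 - A\<^sup>2 = 2 * (z \<bullet> w) + (norm w)\<^sup>2"
    unfolding A2 B2 by (simp add: power2_norm_eq_inner inner_simps inner_commute)
  moreover have "2 * A * B \<le> A\<^sup>2 + B\<^sup>2" by (rule sum_squares_bound)
  ultimately have "2 * A * B \<le> 2 * A\<^sup>2 + 2 * (z \<bullet> w) + (norm w)\<^sup>2" by linarith
  then have "B \<le> (2 * A\<^sup>2 + 2 * (z \<bullet> w) + (norm w)\<^sup>2) / (2 * A)"
    using A by (simp add: pos_le_divide_eq mult.commute mult.left_commute)
  also have "\<dots> = A + (z \<bullet> w) / A + (norm w)\<^sup>2 / (2 * A)"
    using A by (simp add: field_simps power2_eq_square)
  finally show ?thesis by (simp add: A_def B_def)
qed

section \<open>Approximate multipliers under subregularity\<close>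

text \<open>Compare \<open>y\<close> with its projection \<open>c\<close> onto \<open>C\<close>. As \<open>x \<in> C\<close>, the point \<open>c\<close> is at most twice as far from \<open>x\<close>
  as \<open>y\<close> is, hence the radius \<open>r / 2\<close>; moving from \<open>y\<close> to \<open>c\<close> changes \<open>y \<mapsto> \<epsilon> dist y x - \<xi> \<bullet> (y - x)\<close>
  by at most its Lipschitz constant times \<open>infdist y C\<close>.\<close>

lemma exact_penalty:
  fixes C :: "'a::euclidean_space set"
  assumes "closed C" "x \<in> C"
    and normal: "\<And>y. \<lbrakk>y \<in> C; dist y x < r\<rbrakk> \<Longrightarrow> \<xi> \<bullet> (y - x) \<le> \<epsilon> * dist y x"
    and "\<epsilon> \<ge> 0" "dist y x < r / 2"
  shows "\<xi> \<bullet> (y - x) \<le> \<epsilon> * dist y x + (norm \<xi> + \<epsilon>) * infdist y C"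
proof -
  obtain c where c: "c \<in> C" "infdist y C = dist y c"
    using infdist_attains_inf[of C y] assms(1,2) by blast
  have near: "dist y c \<le> dist y x"
    using infdist_le[OF assms(2), of y] c(2) by simp
  have "dist c x \<le> dist y c + dist y x"
    by (metis dist_triangle3)
  with near assms(5) have "dist c x < r" by linarith
  then have 1: "\<xi> \<bullet> (c - x) \<le> \<epsilon> * dist c x" by (rule normal[OF c(1)])
  have 2: "\<xi> \<bullet> (y - c) \<le> norm \<xi> * dist y c"
    unfolding dist_norm by (rule norm_cauchy_schwarz)
  have 3: "\<epsilon> * dist c x \<le> \<epsilon> * (dist y c + dist y x)"
    by (rule mult_left_mono) fact+
  have "\<xi> \<bullet> (y - x) = \<xi> \<bullet> (c - x) + \<xi> \<bullet> (y - c)" by (simp add: inner_simps)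
  with 1 2 3 show ?thesis unfolding c(2) by (simp add: algebra_simps)
qed

text \<open>Adding \<open>\<epsilon> dist y x + dist (\<phi> y) q\<close> to the exact penalty function forces near-minimizers to be close
  to \<open>(x, \<phi> x)\<close>, whatever small smoothing parameter \<open>s\<close> is used; \<open>s\<close> is then chosen so small that the
  minimizer lies in the interior of the balls that make the problem compact. Freezing the first
  variable at the minimizer gives the normal to \<open>Q\<close>, freezing the second gives the normal to the graph.\<close>

lemma approximate_multiplier:
  fixes \<phi> :: "'a::euclidean_space \<Rightarrow> 'b::euclidean_space"
  assumes "closed Q" and cont: "continuous_on UNIV \<phi>"
    and \<xi>: "\<xi> \<in> regular_normal_cone (\<phi> -` Q) x"
    and "\<kappa> \<ge> 0" "r\<^sub>0 > 0"
    and subreg: "\<And>y q. \<lbrakk>dist y x < r\<^sub>0; q \<in> Q\<rbrakk> \<Longrightarrow> infdist y (\<phi> -` Q) \<le> \<kappa> * dist (\<phi> y) q"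
    and "\<gamma> > 0"
  obtains x' q \<xi>' \<eta> where
    "dist x' x < \<gamma>" "dist (\<phi> x') (\<phi> x) < \<gamma>" "dist q (\<phi> x') < \<gamma>" "norm (\<xi>' - \<xi>) \<le> \<gamma>"
    "(\<xi>', - \<eta>) \<in> regular_normal_cone (gph \<phi>) (x', \<phi> x')"
    "\<eta> \<in> regular_normal_cone Q q" "norm \<eta> \<le> \<kappa> * (norm \<xi> + \<gamma>) + 1"
proof -
  \<comment> \<open>The smoothed term for the distance to \<open>x\<close> carries the factor \<open>2 * \<epsilon> = \<gamma>\<close>: one \<open>\<epsilon>\<close> absorbs the
    error in the definition of a regular normal, the other one keeps minimizers near \<open>x\<close>. Likewise
    the summand \<open>1\<close> in \<open>M\<close> keeps \<open>q\<close> near \<open>\<phi> x'\<close>.\<close>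
  define \<epsilon> where "\<epsilon> = \<gamma> / 2"
  define M where "M = \<kappa> * (norm \<xi> + \<gamma>) + 1"
  have \<epsilon>: "\<epsilon> > 0" using \<open>\<gamma> > 0\<close> by (simp add: \<epsilon>_def)
  have M: "M > 0" using \<open>\<gamma> > 0\<close> \<open>\<kappa> \<ge> 0\<close> by (simp add: M_def add_nonneg_pos)
  have clC: "closed (\<phi> -` Q)" using assms(1) cont by (simp add: closed_vimage)
  have xC: "x \<in> \<phi> -` Q" using \<xi> by (simp add: regular_normal_cone_def)
  obtain r\<^sub>1 where r1: "r\<^sub>1 > 0"
    "\<And>y. \<lbrakk>y \<in> \<phi> -` Q; dist y x < r\<^sub>1\<rbrakk> \<Longrightarrow> \<xi> \<bullet> (y - x) \<le> \<epsilon> * dist y x"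
    using \<xi> \<epsilon> unfolding mem_regular_normal_cone_iff by meson
  define r where "r = min r\<^sub>0 r\<^sub>1 / 3"
  have r: "r > 0" "r < r\<^sub>0" "r < r\<^sub>1 / 2" using \<open>r\<^sub>0 > 0\<close> r1(1) by (auto simp: r_def)
  have penalty: "\<xi> \<bullet> (y - x) \<le> \<epsilon> * dist y x + (M - 1) * dist (\<phi> y) q"
    if "dist y x \<le> r" "q \<in> Q" for y q
  proof -
    have "\<xi> \<bullet> (y - x) \<le> \<epsilon> * dist y x + (norm \<xi> + \<epsilon>) * infdist y (\<phi> -` Q)"
      using exact_penalty[OF clC xC r1(2)] \<epsilon> r that by simp
    also have "(norm \<xi> + \<epsilon>) * infdist y (\<phi> -` Q) \<le> (norm \<xi> + \<gamma>) * (\<kappa> * dist (\<phi> y) q)"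
      using subreg[of y q] that r \<open>\<gamma> > 0\<close>
      by (intro mult_mono) (auto simp: \<epsilon>_def infdist_nonneg)
    finally show ?thesis by (simp add: M_def mult_ac)
  qed
  define e where "e = min \<gamma> (1/2)"
  have e: "e > 0" "e \<le> \<gamma>" "e \<le> 1/2" using \<open>\<gamma> > 0\<close> by (auto simp: e_def)
  obtain \<delta> where \<delta>: "\<delta> > 0" "\<And>y. dist y x < \<delta> \<Longrightarrow> dist (\<phi> y) (\<phi> x) < e"
    using cont e(1) unfolding continuous_on_iff by (metis UNIV_I)
  \<comment> \<open>At \<open>(x, \<phi> x)\<close> the smoothed objective \<open>f\<close> below equals \<open>(2 * \<epsilon> + M) * s\<close>. Keeping this under \<open>a\<close>
    makes every minimizer satisfy the strict bounds \<open>r\<close>, \<open>\<delta>\<close>, \<open>\<gamma>\<close> and \<open>e\<close>.\<close>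
  define a where "a = min (\<epsilon> * min r (min \<delta> \<gamma>)) e"
  have a: "a > 0" using \<epsilon> r \<delta>(1) \<open>\<gamma> > 0\<close> e(1) by (simp add: a_def)
  define s where "s = a / 2 / (2 * \<epsilon> + M)"
  have s: "s > 0" using a \<epsilon> M by (simp add: s_def)
  have s_small: "(2 * \<epsilon> + M) * s < a"
  proof -
    have "D * (a / 2 / D) = a / 2" if "D > 0" for D using that by simp
    from this[of "2 * \<epsilon> + M"] have "(2 * \<epsilon> + M) * s = a / 2"
      using \<epsilon> M by (simp only: s_def)
    with a show ?thesis by simp
  qed
  define f where "f = (\<lambda>p. - (\<xi> \<bullet> (fst p - x)) + 2 * \<epsilon> * soft_norm s (fst p - x)
                            + M * soft_norm s (\<phi> (fst p) - snd p))"
  define K where "K = cball x r \<times> (Q \<inter> cball (\<phi> x) 1)"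
  have f_lower: "\<epsilon> * dist y x + dist (\<phi> y) q \<le> f (y, q)" if "dist y x \<le> r" "q \<in> Q" for y q
  proof -
    have "\<epsilon> * (2 * dist y x) \<le> \<epsilon> * (2 * soft_norm s (y - x))"
      "M * dist (\<phi> y) q \<le> M * soft_norm s (\<phi> y - q)"
      using \<epsilon> M norm_le_soft_norm by (auto simp: dist_norm)
    with penalty[OF that] show ?thesis by (simp add: f_def algebra_simps)
  qed
  have f_start: "f (x, \<phi> x) = (2 * \<epsilon> + M) * s"
    by (simp add: f_def soft_norm_zero[OF s] algebra_simps)
  have "compact K" unfolding K_def
    using assms(1) by (intro compact_Times closed_Int_compact) auto
  moreover have "continuous_on K f" unfolding f_def
    by (intro continuous_intros continuous_on_compose2[OF cont]) auto
  moreover have start: "(x, \<phi> x) \<in> K" using xC r by (simp add: K_def)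
  ultimately obtain p where p: "p \<in> K" "\<And>p'. p' \<in> K \<Longrightarrow> f p \<le> f p'"
    using continuous_attains_inf[of K f] by blast
  obtain x' q where p_eq: "p = (x', q)" by (cases p)
  have mem: "dist x' x \<le> r" "q \<in> Q" using p(1) by (auto simp: p_eq K_def dist_commute)
  have min: "f (x', q) \<le> f (y, q')" if "dist y x \<le> r" "q' \<in> Q" "dist q' (\<phi> x) \<le> 1" for y q'
    using p(2)[of "(y, q')"] that by (simp add: p_eq K_def dist_commute)
  have small: "\<epsilon> * dist x' x + dist (\<phi> x') q < a"
    using f_lower[OF mem] min[of x "\<phi> x"] xC r f_start s_small by simp
  have "\<epsilon> * dist x' x < \<epsilon> * min r (min \<delta> \<gamma>)"
    using small a_def zero_le_dist[of "\<phi> x'" q] by linarith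
  then have x'_near: "dist x' x < r" "dist x' x < \<delta>" "dist x' x < \<gamma>" using \<epsilon> by auto
  have q_near: "dist (\<phi> x') q < e"
    using small a_def \<epsilon> mult_nonneg_nonneg[of \<epsilon> "dist x' x"] zero_le_dist[of x' x] by linarith
  have y'_near: "dist (\<phi> x') (\<phi> x) < e" by (rule \<delta>(2)) fact
  have q_interior: "dist q (\<phi> x) < 1"
    using dist_triangle3[of q "\<phi> x" "\<phi> x'"] q_near y'_near e(3) by linarith
  define A where "A = soft_norm s (x' - x)"
  define B where "B = soft_norm s (\<phi> x' - q)"
  have AB: "A > 0" "B > 0" using soft_norm_pos[OF s] by (auto simp: A_def B_def)
  \<comment> \<open>The perturbation of \<open>\<xi>\<close> is the gradient of the smoothed distance to \<open>x\<close>; \<open>\<eta>\<close> is the gradient of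
    the coupling term with respect to \<open>\<phi> x'\<close>, hence minus its gradient with respect to \<open>q\<close>.\<close>
  define \<xi>' where "\<xi>' = \<xi> - (\<gamma> / A) *\<^sub>R (x' - x)"
  define \<eta> where "\<eta> = (M / B) *\<^sub>R (\<phi> x' - q)"
  show ?thesis
  proof (rule that)
    show "dist x' x < \<gamma>" "dist (\<phi> x') (\<phi> x) < \<gamma>" "dist q (\<phi> x') < \<gamma>"
      using x'_near y'_near q_near e(2) by (auto simp: dist_commute)
    show "norm (\<xi>' - \<xi>) \<le> \<gamma>"
      using norm_scaled_by_soft_norm_le[OF s, of \<gamma> "x' - x"] \<open>\<gamma> > 0\<close>
      by (simp add: \<xi>'_def A_def)
    show "norm \<eta> \<le> \<kappa> * (norm \<xi> + \<gamma>) + 1"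
      using norm_scaled_by_soft_norm_le[OF s, of M "\<phi> x' - q"] M
      by (simp add: \<eta>_def B_def M_def)
    show "\<eta> \<in> regular_normal_cone Q q"
    proof (rule regular_normal_coneI_quadratic[where r = "1 - dist q (\<phi> x)" and c = "M / (2 * B)"])
      fix q' assume q': "q' \<in> Q" "dist q' q < 1 - dist q (\<phi> x)"
      have "dist q' (\<phi> x) \<le> 1" using dist_triangle[of q' "\<phi> x" q] q'(2) by linarith
      from min[OF mem(1) q'(1) this]
      have "M * B \<le> M * soft_norm s ((\<phi> x' - q) + (q - q'))" by (simp add: f_def B_def)
      also have "\<dots> \<le> M * (B + ((\<phi> x' - q) \<bullet> (q - q')) / B + (norm (q - q'))\<^sup>2 / (2 * B))"
        using soft_norm_quadratic_upper_bound[OF s, of "\<phi> x' - q" "q - q'"] M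
        unfolding B_def by (intro mult_left_mono) auto
      finally have "0 \<le> M / B * ((\<phi> x' - q) \<bullet> (q - q')) + M / (2 * B) * (norm (q - q'))\<^sup>2"
        by (simp add: distrib_left)
      moreover have "\<eta> \<bullet> (q' - q) = - (\<eta> \<bullet> (q - q'))" by (simp add: inner_diff_right)
      then have "\<eta> \<bullet> (q' - q) = - (M / B * ((\<phi> x' - q) \<bullet> (q - q')))" by (simp add: \<eta>_def)
      ultimately show "\<eta> \<bullet> (q' - q) \<le> M / (2 * B) * (norm (q' - q))\<^sup>2"
        by (simp add: norm_minus_commute)
    qed (use mem q_interior in auto)
    show "(\<xi>', - \<eta>) \<in> regular_normal_cone (gph \<phi>) (x', \<phi> x')"
    proof (rule regular_normal_coneI_quadratic[where r = "r - dist x' x" and c = "\<epsilon> / A + M / (2 * B)"])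
      fix g assume g: "g \<in> gph \<phi>" "dist g (x', \<phi> x') < r - dist x' x"
      define y where "y = fst g"
      have g_eq: "g = (y, \<phi> y)" using g(1) by (auto simp: gph_def y_def)
      have "dist y x' < r - dist x' x" using g(2) dist_fst_le[of g "(x', \<phi> x')"] by (simp add: y_def)
      then have "dist y x \<le> r" using dist_triangle[of y x x'] by linarith
      from min[OF this mem(2)] q_interior
      have "\<xi> \<bullet> (y - x') + \<gamma> * A + M * B
              \<le> \<gamma> * soft_norm s ((x' - x) + (y - x')) + M * soft_norm s ((\<phi> x' - q) + (\<phi> y - \<phi> x'))"
        by (simp add: f_def A_def B_def \<epsilon>_def inner_simps)
      also have "\<dots> \<le> \<gamma> * (A + ((x' - x) \<bullet> (y - x')) / A + (norm (y - x'))\<^sup>2 / (2 * A))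
            + M * (B + ((\<phi> x' - q) \<bullet> (\<phi> y - \<phi> x')) / B + (norm (\<phi> y - \<phi> x'))\<^sup>2 / (2 * B))"
        using soft_norm_quadratic_upper_bound[OF s, of "x' - x" "y - x'"]
          soft_norm_quadratic_upper_bound[OF s, of "\<phi> x' - q" "\<phi> y - \<phi> x'"] M \<open>\<gamma> > 0\<close>
        unfolding A_def B_def by (intro add_mono mult_left_mono) auto
      finally have "\<xi> \<bullet> (y - x') - \<gamma> / A * ((x' - x) \<bullet> (y - x')) - M / B * ((\<phi> x' - q) \<bullet> (\<phi> y - \<phi> x'))
          \<le> \<epsilon> / A * (norm (y - x'))\<^sup>2 + M / (2 * B) * (norm (\<phi> y - \<phi> x'))\<^sup>2"
        by (simp add: distrib_left \<epsilon>_def)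
      also have "\<dots> \<le> \<epsilon> / A * (norm (g - (x', \<phi> x')))\<^sup>2 + M / (2 * B) * (norm (g - (x', \<phi> x')))\<^sup>2"
        using AB \<epsilon> M by (intro add_mono mult_left_mono) (auto simp: g_eq norm_Pair)
      also have "\<xi> \<bullet> (y - x') - \<gamma> / A * ((x' - x) \<bullet> (y - x')) - M / B * ((\<phi> x' - q) \<bullet> (\<phi> y - \<phi> x'))
          = (\<xi>', - \<eta>) \<bullet> (g - (x', \<phi> x'))"
        by (simp add: g_eq \<xi>'_def \<eta>_def inner_diff_left[of \<xi>])
      finally show "(\<xi>', - \<eta>) \<bullet> (g - (x', \<phi> x'))
          \<le> (\<epsilon> / A + M / (2 * B)) * (norm (g - (x', \<phi> x')))\<^sup>2"
        by (simp add: distrib_right)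
    qed (use x'_near in \<open>auto simp: gph_def\<close>)
  qed
qed

section \<open>Multipliers along a directional sequence\<close>

text \<open>Replacing the inequality that describes \<open>basic_dir_nbhd\<close> by a strict one gives an open set; that it still
  contains \<open>t k *\<^sub>R hs k\<close> eventually is a question about \<open>hs k\<close> alone, because the inequality is
  positively homogeneous. For \<open>h = 0\<close> the strict inequality has no solution while the
  neighborhood is a full ball, so this case is separate. Openness is what allows a condition that holds on the
  neighborhood to be used around, and not only at, the points of the sequence.\<close>

lemma dir_nbhd_open_core:
  assumes "dir_nbhd h U"
  obtains W where "open W" "W \<subseteq> U"
    "\<And>t hs. \<lbrakk>seq_down_zero t; hs \<longlonglongrightarrow> h\<rbrakk> \<Longrightarrow> \<forall>\<^sub>F k in sequentially. t k *\<^sub>R hs k \<in> W"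
proof -
  obtain \<rho> \<delta> where \<rho>: "\<rho> > 0" "\<delta> > 0" "basic_dir_nbhd \<rho> \<delta> h \<subseteq> U"
    using assms by (auto simp: dir_nbhd_def)
  define W where "W = ball 0 \<rho> \<inter>
    (if h = 0 then UNIV else {z. norm (norm h *\<^sub>R z - norm z *\<^sub>R h) < \<delta> * norm z * norm h})"
  show ?thesis
  proof (rule that)
    show "open W" unfolding W_def
      by (auto intro!: open_Int open_Collect_less continuous_intros)
    have "W \<subseteq> basic_dir_nbhd \<rho> \<delta> h"
      by (auto simp: W_def basic_dir_nbhd_def split: if_splits)
    with \<rho>(3) show "W \<subseteq> U" by simp
  next
    fix t and hs :: "nat \<Rightarrow> 'a" assume t: "seq_down_zero t" and hs: "hs \<longlonglongrightarrow> h"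
    have "(\<lambda>k. t k *\<^sub>R hs k) \<longlonglongrightarrow> 0 *\<^sub>R h"
      using t hs unfolding seq_down_zero_def by (intro tendsto_scaleR) auto
    then have "\<forall>\<^sub>F k in sequentially. dist (t k *\<^sub>R hs k) 0 < \<rho>"
      using \<rho>(1) by (intro tendstoD) auto
    then have 1: "\<forall>\<^sub>F k in sequentially. t k *\<^sub>R hs k \<in> ball 0 \<rho>" by (simp add: dist_commute)
    show "\<forall>\<^sub>F k in sequentially. t k *\<^sub>R hs k \<in> W"
    proof (cases "h = 0")
      case True
      with 1 show ?thesis by (simp add: W_def)
    next
      case False
      have "(\<lambda>k. \<delta> * norm (hs k) * norm h - norm (norm h *\<^sub>R hs k - norm (hs k) *\<^sub>R h))
              \<longlonglongrightarrow> \<delta> * norm h * norm h - norm (norm h *\<^sub>R h - norm h *\<^sub>R h)"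
        using hs by (intro tendsto_intros)
      moreover have "\<delta> * norm h * norm h - norm (norm h *\<^sub>R h - norm h *\<^sub>R h) > 0"
        using False \<rho>(2) by simp
      ultimately have "\<forall>\<^sub>F k in sequentially.
          0 < \<delta> * norm (hs k) * norm h - norm (norm h *\<^sub>R hs k - norm (hs k) *\<^sub>R h)"
        by (rule order_tendstoD(1))
      with 1 show ?thesis
      proof eventually_elim
        case (elim k)
        have tk: "t k > 0" using t by (simp add: seq_down_zero_def)
        have "norm h *\<^sub>R (t k *\<^sub>R hs k) - norm (t k *\<^sub>R hs k) *\<^sub>R h
                = t k *\<^sub>R (norm h *\<^sub>R hs k - norm (hs k) *\<^sub>R h)"
          using tk by (simp add: algebra_simps)
        then have "norm (norm h *\<^sub>R (t k *\<^sub>R hs k) - norm (t k *\<^sub>R hs k) *\<^sub>R h)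
                = t k * norm (norm h *\<^sub>R hs k - norm (hs k) *\<^sub>R h)"
          using tk by simp
        also have "\<dots> < t k * (\<delta> * norm (hs k) * norm h)"
          using elim(2) tk by (intro mult_strict_left_mono) auto
        also have "\<dots> = \<delta> * norm (t k *\<^sub>R hs k) * norm h" using tk by simp
        finally show ?case using elim(1) False by (simp add: W_def)
      qed
    qed
  qed
qed

lemma infdist_preimage_le_of_edist:
  assumes "edist_set (\<phi> -` Q) y \<le> ereal \<kappa> * edist_set ((\<lambda>q. q - \<phi> y) ` Q) 0"
    and "\<kappa> \<ge> 0" "\<phi> -` Q \<noteq> {}" "q \<in> Q"
  shows "infdist y (\<phi> -` Q) \<le> \<kappa> * norm (\<phi> y - q)"
proof -
  have "ereal (infdist y (\<phi> -` Q)) \<le> edist_set (\<phi> -` Q) y"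
    unfolding edist_set_def by (intro INF_greatest) (simp add: infdist_le)
  also have "\<dots> \<le> ereal \<kappa> * edist_set ((\<lambda>q. q - \<phi> y) ` Q) 0" by fact
  also have "\<dots> \<le> ereal \<kappa> * ereal (dist 0 (q - \<phi> y))"
    unfolding edist_set_def using assms(2,4)
    by (intro ereal_mult_left_mono INF_lower) auto
  finally show ?thesis by (simp add: dist_norm norm_minus_commute)
qed

text \<open>The multiplier rule is applied at the \<open>k\<close>-th point with precision \<open>(t k)\<^sup>2\<close>. This is \<open>o(t k)\<close>, so that
  neither the direction \<open>h\<close> nor the tangential position of \<open>qs k\<close> relative to the graph is
  affected by moving to the new base points.\<close>

lemma subregular_multiplier_sequences:
  fixes \<phi> :: "'a::euclidean_space \<Rightarrow> 'b::euclidean_space"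
  assumes Q: "closed Q" and cont: "continuous_on UNIV \<phi>"
    and subreg: "metrically_subregular_dir (\<lambda>x. (\<lambda>q. q - \<phi> x) ` Q) xbar 0 h"
    and \<xi>: "\<xi> \<in> dir_normal_cone (\<phi> -` Q) xbar h"
  obtains t xs qs \<xi>s \<eta>s where
    "seq_down_zero t" "(\<lambda>k. (xs k - xbar) /\<^sub>R t k) \<longlonglongrightarrow> h"
    "(\<lambda>k. (qs k - \<phi> (xs k)) /\<^sub>R t k) \<longlonglongrightarrow> 0" "\<xi>s \<longlonglongrightarrow> \<xi>" "bounded (range \<eta>s)"
    "\<And>k. (\<xi>s k, - \<eta>s k) \<in> regular_normal_cone (gph \<phi>) (xs k, \<phi> (xs k))"
    "\<And>k. \<eta>s k \<in> regular_normal_cone Q (qs k)"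
proof -
  have F_inv: "{x. 0 \<in> (\<lambda>q. q - \<phi> x) ` Q} = \<phi> -` Q" by auto
  obtain \<kappa> U where \<kappa>: "\<kappa> > 0" "dir_nbhd h U"
    "\<And>z. z \<in> U \<Longrightarrow> edist_set (\<phi> -` Q) (xbar + z)
                \<le> ereal \<kappa> * edist_set ((\<lambda>q. q - \<phi> (xbar + z)) ` Q) 0"
    using subreg unfolding metrically_subregular_dir_def F_inv by blast
  obtain W where W: "open W" "W \<subseteq> U"
    "\<And>t hs. \<lbrakk>seq_down_zero t; hs \<longlonglongrightarrow> h\<rbrakk> \<Longrightarrow> \<forall>\<^sub>F k in sequentially. t k *\<^sub>R hs k \<in> W"
    using dir_nbhd_open_core[OF \<kappa>(2)] by metis
  obtain t0 hs0 \<zeta>0 where 0: "seq_down_zero t0" "hs0 \<longlonglongrightarrow> h" "\<zeta>0 \<longlonglongrightarrow> \<xi>"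
    "\<And>k. \<zeta>0 k \<in> regular_normal_cone (\<phi> -` Q) (xbar + t0 k *\<^sub>R hs0 k)"
    using \<xi> unfolding dir_normal_cone_def by blast
  \<comment> \<open>Subregularity can be used only once the sequence has entered the neighborhood of \<open>h\<close>.\<close>
  obtain N where N: "\<And>k. k \<ge> N \<Longrightarrow> t0 k *\<^sub>R hs0 k \<in> W"
    using W(3)[OF 0(1,2)] unfolding eventually_sequentially by blast
  define t where "t = (\<lambda>k. t0 (k + N))"
  define hs where "hs = (\<lambda>k. hs0 (k + N))"
  define \<zeta> where "\<zeta> = (\<lambda>k. \<zeta>0 (k + N))"
  have t: "\<And>k. t k > 0" "t \<longlonglongrightarrow> 0" and hs: "hs \<longlonglongrightarrow> h" and \<zeta>: "\<zeta> \<longlonglongrightarrow> \<xi>"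
    using 0(1-3) unfolding t_def hs_def \<zeta>_def seq_down_zero_def
    by (auto intro: LIMSEQ_ignore_initial_segment)
  have "\<exists>x' q \<xi>' \<eta>. dist x' (xbar + t k *\<^sub>R hs k) < (t k)\<^sup>2 \<and> dist q (\<phi> x') < (t k)\<^sup>2 \<and>
          norm (\<xi>' - \<zeta> k) \<le> (t k)\<^sup>2 \<and>
          (\<xi>', - \<eta>) \<in> regular_normal_cone (gph \<phi>) (x', \<phi> x') \<and>
          \<eta> \<in> regular_normal_cone Q q \<and> norm \<eta> \<le> \<kappa> * (norm (\<zeta> k) + (t k)\<^sup>2) + 1" for k
  proof -
    have "t k *\<^sub>R hs k \<in> W" using N[of "k + N"] by (simp add: t_def hs_def)
    then obtain r where r: "r > 0" "ball (t k *\<^sub>R hs k) r \<subseteq> W"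
      using W(1) open_contains_ball by blast
    have reg: "\<zeta> k \<in> regular_normal_cone (\<phi> -` Q) (xbar + t k *\<^sub>R hs k)"
      using 0(4) by (simp add: t_def hs_def \<zeta>_def)
    then have ne: "\<phi> -` Q \<noteq> {}" by (auto simp: regular_normal_cone_def)
    have "infdist y (\<phi> -` Q) \<le> \<kappa> * dist (\<phi> y) q"
      if "dist y (xbar + t k *\<^sub>R hs k) < r" "q \<in> Q" for y q
    proof -
      have "y - xbar \<in> ball (t k *\<^sub>R hs k) r"
        using that(1) by (simp add: dist_norm norm_minus_commute algebra_simps)
      then have "y - xbar \<in> U" using r(2) W(2) by blast
      from \<kappa>(3)[OF this] show ?thesis
        using infdist_preimage_le_of_edist[of \<phi> Q y \<kappa> q] \<kappa>(1) ne that(2) by (simp add: dist_norm)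
    qed
    from approximate_multiplier[OF Q cont reg less_imp_le[OF \<kappa>(1)] r(1) this, of "(t k)\<^sup>2"] t(1)[of k]
    show ?thesis by (metis zero_less_power)
  qed
  then obtain xs qs \<xi>s \<eta>s where seqs:
    "\<And>k. dist (xs k) (xbar + t k *\<^sub>R hs k) < (t k)\<^sup>2" "\<And>k. dist (qs k) (\<phi> (xs k)) < (t k)\<^sup>2"
    "\<And>k. norm (\<xi>s k - \<zeta> k) \<le> (t k)\<^sup>2"
    "\<And>k. (\<xi>s k, - \<eta>s k) \<in> regular_normal_cone (gph \<phi>) (xs k, \<phi> (xs k))"
    "\<And>k. \<eta>s k \<in> regular_normal_cone Q (qs k)"
    "\<And>k. norm (\<eta>s k) \<le> \<kappa> * (norm (\<zeta> k) + (t k)\<^sup>2) + 1"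
    by metis
  have scaled: "(\<lambda>k. z k /\<^sub>R t k) \<longlonglongrightarrow> 0" if "\<And>k. norm (z k) < (t k)\<^sup>2" for z :: "nat \<Rightarrow> 'c::real_normed_vector"
  proof (rule Lim_null_comparison[OF _ t(2)], rule always_eventually, rule allI)
    fix k
    show "norm (z k /\<^sub>R t k) \<le> t k"
      using that[of k] t(1)[of k] by (simp add: field_simps power2_eq_square)
  qed
  show ?thesis
  proof (rule that)
    show "seq_down_zero t" using t by (simp add: seq_down_zero_def)
    have "(\<lambda>k. (xs k - (xbar + t k *\<^sub>R hs k)) /\<^sub>R t k + hs k) \<longlonglongrightarrow> 0 + h"
      using seqs(1) hs by (intro tendsto_add scaled) (auto simp: dist_norm)
    moreover have "(xs k - (xbar + t k *\<^sub>R hs k)) /\<^sub>R t k + hs k = (xs k - xbar) /\<^sub>R t k" for k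
      using t(1)[of k] by (simp add: algebra_simps)
    ultimately show "(\<lambda>k. (xs k - xbar) /\<^sub>R t k) \<longlonglongrightarrow> h" by simp
    show "(\<lambda>k. (qs k - \<phi> (xs k)) /\<^sub>R t k) \<longlonglongrightarrow> 0"
      using seqs(2) by (intro scaled) (simp add: dist_norm)
    have t2: "(\<lambda>k. (t k)\<^sup>2) \<longlonglongrightarrow> 0" using tendsto_power[OF t(2), of 2] by simp
    have "(\<lambda>k. \<xi>s k - \<zeta> k) \<longlonglongrightarrow> 0"
      by (rule Lim_null_comparison[OF _ t2]) (use seqs(3) in auto)
    from tendsto_add[OF this \<zeta>] show "\<xi>s \<longlonglongrightarrow> \<xi>" by simp
    have "(\<lambda>k. \<kappa> * (norm (\<zeta> k) + (t k)\<^sup>2) + 1) \<longlonglongrightarrow> \<kappa> * (norm \<xi> + 0) + 1"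
      by (intro tendsto_intros \<zeta> t2)
    then have "Bseq (\<lambda>k. \<kappa> * (norm (\<zeta> k) + (t k)\<^sup>2) + 1)"
      by (intro convergent_imp_Bseq convergentI)
    then have "Bseq \<eta>s"
    proof (rule Bseq_eventually_mono[rotated], intro always_eventually allI)
      fix k
      show "norm (\<eta>s k) \<le> norm (\<kappa> * (norm (\<zeta> k) + (t k)\<^sup>2) + 1)"
        using order_trans[OF seqs(6)[of k] abs_ge_self] by simp
    qed
    then show "bounded (range \<eta>s)" by (simp add: Bseq_eq_bounded)
  qed (fact seqs(4,5))+
qed

section \<open>Passage to the limit\<close>

text \<open>The scale \<open>\<tau>\<close> need not be the step length of the original directional sequence: any scale at
  which the increments of \<open>\<phi>\<close> stay in a compact set \<open>S\<close> will do. A common convergent subsequence of the scaled increments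
  and of the multipliers yields \<open>v\<close> and \<open>\<eta>\<close>, and the same sequences witness all the memberships in cones.\<close>

lemma rescaled_multiplier_limit:
  fixes \<phi> :: "'a::euclidean_space \<Rightarrow> 'b::euclidean_space"
  assumes xbar: "\<phi> xbar \<in> Q" and \<tau>: "seq_down_zero \<tau>"
    and x: "(\<lambda>k. (xs k - xbar) /\<^sub>R \<tau> k) \<longlonglongrightarrow> u"
    and S: "compact S" "\<And>k. (\<phi> (xs k) - \<phi> xbar) /\<^sub>R \<tau> k \<in> S"
    and q: "(\<lambda>k. (qs k - \<phi> (xs k)) /\<^sub>R \<tau> k) \<longlonglongrightarrow> 0"
    and \<xi>s: "\<xi>s \<longlonglongrightarrow> \<xi>" and \<eta>s: "bounded (range \<eta>s)"
    and graph: "\<And>k. (\<xi>s k, - \<eta>s k) \<in> regular_normal_cone (gph \<phi>) (xs k, \<phi> (xs k))"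
    and target: "\<And>k. \<eta>s k \<in> regular_normal_cone Q (qs k)"
  shows "\<exists>v \<in> S \<inter> graphical_derivative \<phi> xbar u \<inter> tangent_cone Q (\<phi> xbar).
           \<xi> \<in> dir_coderivative_image \<phi> xbar (u, v) (dir_normal_cone Q (\<phi> xbar) v)"
proof -
  define vs where "vs = (\<lambda>k. (\<phi> (xs k) - \<phi> xbar) /\<^sub>R \<tau> k)"
  have compact: "seq_compact (S \<times> closure (range \<eta>s))"
    using S(1) \<eta>s by (intro compact_imp_seq_compact compact_Times) simp_all
  have "\<forall>k. (vs k, \<eta>s k) \<in> S \<times> closure (range \<eta>s)"
    using S(2) closure_subset[of "range \<eta>s"] by (auto simp: vs_def)
  from seq_compactE[OF compact this] obtain l r where l: "l \<in> S \<times> closure (range \<eta>s)" and r: "strict_mono r"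
    and lim: "((\<lambda>k. (vs k, \<eta>s k)) \<circ> r) \<longlonglongrightarrow> l"
    by metis
  obtain v \<eta> where l_eq: "l = (v, \<eta>)" by (cases l)
  have v: "(\<lambda>k. vs (r k)) \<longlonglongrightarrow> v" and \<eta>: "(\<lambda>k. \<eta>s (r k)) \<longlonglongrightarrow> \<eta>"
    using tendsto_fst[OF lim] tendsto_snd[OF lim] by (simp_all add: o_def l_eq)
  have pos: "\<tau> k > 0" for k using \<tau> by (simp add: seq_down_zero_def)
  have \<tau>r: "seq_down_zero (\<lambda>k. \<tau> (r k))"
    using \<tau> LIMSEQ_subseq_LIMSEQ[OF _ r, of \<tau> 0] by (auto simp: seq_down_zero_def o_def)
  define us where "us = (\<lambda>k. (xs (r k) - xbar) /\<^sub>R \<tau> (r k))"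
  have us: "us \<longlonglongrightarrow> u" using LIMSEQ_subseq_LIMSEQ[OF x r] by (simp add: o_def us_def)
  define ws where "ws = (\<lambda>k. (qs (r k) - \<phi> xbar) /\<^sub>R \<tau> (r k))"
  have "(\<lambda>k. (qs (r k) - \<phi> (xs (r k))) /\<^sub>R \<tau> (r k) + vs (r k)) \<longlonglongrightarrow> 0 + v"
    using LIMSEQ_subseq_LIMSEQ[OF q r] v by (intro tendsto_add) (simp_all add: o_def)
  then have ws: "ws \<longlonglongrightarrow> v" by (simp add: ws_def vs_def algebra_simps)
  have points: "(xbar, \<phi> xbar) + \<tau> (r k) *\<^sub>R (us k, vs (r k)) = (xs (r k), \<phi> (xs (r k)))"
      "\<phi> xbar + \<tau> (r k) *\<^sub>R ws k = qs (r k)" for k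
    using pos[of "r k"] by (simp_all add: us_def vs_def ws_def)
  have pair: "(\<lambda>k. (us k, vs (r k))) \<longlonglongrightarrow> (u, v)" by (intro tendsto_Pair us v)
  have on_graph: "(xbar, \<phi> xbar) + \<tau> (r k) *\<^sub>R (us k, vs (r k)) \<in> gph \<phi>" for k
    unfolding points by (simp add: gph_def)
  have "v \<in> graphical_derivative \<phi> xbar u"
    unfolding graphical_derivative_def tangent_cone_def mem_Collect_eq
    by (intro conjI exI[of _ "\<lambda>k. (us k, vs (r k))"] exI[of _ "\<lambda>k. \<tau> (r k)"] allI pair \<tau>r on_graph)
       (simp add: gph_def)
  moreover have "qs k \<in> Q" for k using target[of k] by (simp add: regular_normal_cone_def)
  then have "v \<in> tangent_cone Q (\<phi> xbar)"
    unfolding tangent_cone_def mem_Collect_eq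
    by (intro exI[of _ ws] exI[of _ "\<lambda>k. \<tau> (r k)"] conjI allI xbar ws \<tau>r)
       (simp only: points)
  moreover have "\<eta> \<in> dir_normal_cone Q (\<phi> xbar) v"
    unfolding dir_normal_cone_def mem_Collect_eq
    by (intro exI[of _ "\<lambda>k. \<tau> (r k)"] exI[of _ ws] exI[of _ "\<lambda>k. \<eta>s (r k)"] conjI allI \<tau>r ws \<eta>)
       (simp only: points target)
  moreover have "(\<lambda>k. (\<xi>s (r k), - \<eta>s (r k))) \<longlonglongrightarrow> (\<xi>, - \<eta>)"
    using LIMSEQ_subseq_LIMSEQ[OF \<xi>s r] \<eta> by (intro tendsto_Pair tendsto_minus) (simp_all add: o_def)
  then have "\<xi> \<in> dir_coderivative \<phi> xbar (u, v) \<eta>"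
    unfolding dir_coderivative_def dir_normal_cone_def mem_Collect_eq
    by (intro exI[of _ "\<lambda>k. \<tau> (r k)"] exI[of _ "\<lambda>k. (us k, vs (r k))"]
          exI[of _ "\<lambda>k. (\<xi>s (r k), - \<eta>s (r k))"] conjI allI \<tau>r pair)
       (simp_all only: points graph)
  moreover have "v \<in> S" using l l_eq by simp
  ultimately show ?thesis unfolding dir_coderivative_image_def by blast
qed

theorem theorem3p1:
  fixes Q :: "(real ^ 'm) set"
    and \<phi> :: "real ^ 'n \<Rightarrow> real ^ 'm"
    and C :: "(real ^ 'n) set"
    and F :: "real ^ 'n \<Rightarrow> (real ^ 'm) set"
    and xbar h :: "real ^ 'n"
  assumes "closed Q"
    and "continuous_on UNIV \<phi>"
    and "C = \<phi> -` Q"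
    and "xbar \<in> C"
    and "F = (\<lambda>x. (\<lambda>q. q - \<phi> x) ` Q)"
    and "metrically_subregular_dir F xbar 0 h"
  shows "dir_normal_cone C xbar h \<subseteq>
           (\<Union>v \<in> graphical_derivative \<phi> xbar h \<inter> tangent_cone Q (\<phi> xbar).
              dir_coderivative_image \<phi> xbar (h, v) (dir_normal_cone Q (\<phi> xbar) v)) \<union>
           (\<Union>v \<in> graphical_derivative \<phi> xbar 0 \<inter> sphere 0 1 \<inter> tangent_cone Q (\<phi> xbar).
              dir_coderivative_image \<phi> xbar (0, v) (dir_normal_cone Q (\<phi> xbar) v))
       \<and> (calm_dir \<phi> xbar h \<longrightarrow>
           dir_normal_cone C xbar h \<subseteq>
             (\<Union>v \<in> graphical_derivative \<phi> xbar h \<inter> tangent_cone Q (\<phi> xbar).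
                dir_coderivative_image \<phi> xbar (h, v) (dir_normal_cone Q (\<phi> xbar) v)))"
    (is "_ \<subseteq> ?A \<union> ?B \<and> _")
proof -
  have xbar: "\<phi> xbar \<in> Q" using assms(3,4) by simp
  have main: "(\<xi> \<in> ?A \<or> \<xi> \<in> ?B) \<and> (calm_dir \<phi> xbar h \<longrightarrow> \<xi> \<in> ?A)"
    if "\<xi> \<in> dir_normal_cone C xbar h" for \<xi>
  proof -
    have subreg: "metrically_subregular_dir (\<lambda>x. (\<lambda>q. q - \<phi> x) ` Q) xbar 0 h"
      and \<xi>: "\<xi> \<in> dir_normal_cone (\<phi> -` Q) xbar h"
      using assms(3,5,6) that by simp_all
    obtain t xs qs \<xi>s \<eta>s where t: "seq_down_zero t"
      and x: "(\<lambda>k. (xs k - xbar) /\<^sub>R t k) \<longlonglongrightarrow> h"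
      and q: "(\<lambda>k. (qs k - \<phi> (xs k)) /\<^sub>R t k) \<longlonglongrightarrow> 0"
      and \<xi>s: "\<xi>s \<longlonglongrightarrow> \<xi>" and \<eta>s: "bounded (range \<eta>s)"
      and graph: "\<And>k. (\<xi>s k, - \<eta>s k) \<in> regular_normal_cone (gph \<phi>) (xs k, \<phi> (xs k))"
      and target: "\<And>k. \<eta>s k \<in> regular_normal_cone Q (qs k)"
      by (rule subregular_multiplier_sequences[OF assms(1,2) subreg \<xi>]) (rule that)
    have t_pos: "t k > 0" and t_lim: "t \<longlonglongrightarrow> 0" for k
      using t by (simp_all add: seq_down_zero_def)
    have norm_scaled: "norm (z /\<^sub>R c) = norm z / c" if "c > 0" for z :: "'c::real_normed_vector" and c
      using that by (simp add: divide_inverse_commute)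
    define w where "w = (\<lambda>k. \<phi> (xs k) - \<phi> xbar)"
    \<comment> \<open>The scale \<open>t\<close>: if \<open>w\<close> grows at most linearly along a subsequence, the direction \<open>h\<close> is kept.\<close>
    have bounded_case: "\<xi> \<in> ?A" if inf: "infinite {k. norm (w k) \<le> b * t k}" for b
    proof -
      obtain r :: "nat \<Rightarrow> nat" where r: "strict_mono r" "\<forall>k. r k \<in> {k. norm (w k) \<le> b * t k}"
        using infinite_enumerate[OF inf] by blast
      have sub: "(\<lambda>k. f (r k)) \<longlonglongrightarrow> a" if "f \<longlonglongrightarrow> a" for f :: "nat \<Rightarrow> 'c::topological_space" and a
        using LIMSEQ_subseq_LIMSEQ[OF that r(1)] by (simp add: o_def)
      have "\<exists>v \<in> cball 0 b \<inter> graphical_derivative \<phi> xbar h \<inter> tangent_cone Q (\<phi> xbar).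
              \<xi> \<in> dir_coderivative_image \<phi> xbar (h, v) (dir_normal_cone Q (\<phi> xbar) v)"
      proof (rule rescaled_multiplier_limit[OF xbar _ sub[OF x] _ _ sub[OF q] sub[OF \<xi>s]])
        show "seq_down_zero (\<lambda>k. t (r k))"
          using t_pos sub[OF t_lim] by (simp add: seq_down_zero_def)
        show "(\<phi> (xs (r k)) - \<phi> xbar) /\<^sub>R t (r k) \<in> cball 0 b" for k
          using spec[OF r(2), of k] t_pos[of "r k"] by (simp add: norm_scaled pos_divide_le_eq w_def del: norm_scaleR)
        show "bounded (range (\<lambda>k. \<eta>s (r k)))" by (rule bounded_subset[OF \<eta>s]) auto
      qed (use graph target in auto)
      then show ?thesis by blast
    qed
    have xs_lim: "xs \<longlonglongrightarrow> xbar"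
    proof -
      have "(\<lambda>k. xbar + t k *\<^sub>R ((xs k - xbar) /\<^sub>R t k)) \<longlonglongrightarrow> xbar + 0 *\<^sub>R h"
        by (intro tendsto_intros t_lim x)
      moreover have "xbar + t k *\<^sub>R ((xs k - xbar) /\<^sub>R t k) = xs k" for k
        using t_pos[of k] by simp
      ultimately show ?thesis by simp
    qed
    have w_lim: "w \<longlonglongrightarrow> 0"
      using continuous_on_tendsto_compose[OF assms(2) xs_lim]
      by (auto simp: w_def intro: LIM_zero)
    have "\<xi> \<in> ?A \<or> \<xi> \<in> ?B"
    proof (cases "\<exists>b. infinite {k. norm (w k) \<le> b * t k}")
      case True
      with bounded_case show ?thesis by blast
    next
      case False
      then have fast: "\<forall>\<^sub>F k in sequentially. b * t k < norm (w k)" for b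
        by (simp add: not_le cofinite_eq_sequentially[symmetric] eventually_cofinite not_less)
      obtain N where N: "\<And>k. k \<ge> N \<Longrightarrow> 0 * t k < norm (w k)"
        using fast[of 0] unfolding eventually_sequentially by blast
      \<comment> \<open>The scale \<open>norm (w k)\<close>: it dominates \<open>t k\<close>, so the scaled steps \<open>xs k - xbar\<close> tend to zero. The
        shift by \<open>N\<close> makes the scale positive.\<close>
      define \<tau> where "\<tau> = (\<lambda>k. norm (w k))"
      have \<tau>_pos: "\<tau> (k + N) > 0" for k using N[of "k + N"] by (simp add: \<tau>_def)
      have ratio: "(\<lambda>k. t k / \<tau> k) \<longlonglongrightarrow> 0"
      proof (rule tendstoI)
        fix e :: real assume "e > 0"
        show "\<forall>\<^sub>F k in sequentially. dist (t k / \<tau> k) 0 < e"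
          using fast[of "1 / e"]
        proof eventually_elim
          case (elim k)
          have "0 < 1 / e * t k" using t_pos[of k] \<open>e > 0\<close> by simp
          with elim have "\<tau> k > 0" unfolding \<tau>_def by linarith
          with elim \<open>e > 0\<close> t_pos[of k] show ?case by (simp add: \<tau>_def field_simps)
        qed
      qed
      have rescale: "(\<lambda>k. z (k + N) /\<^sub>R \<tau> (k + N)) \<longlonglongrightarrow> 0"
        if "(\<lambda>k. z k /\<^sub>R t k) \<longlonglongrightarrow> a" for z :: "nat \<Rightarrow> 'c::real_normed_vector" and a
      proof -
        have cancel: "(t k / \<tau> k) *\<^sub>R (z k /\<^sub>R t k) = z k /\<^sub>R \<tau> k" for k
          using t_pos[of k] by (simp add: divide_inverse)
        have "(\<lambda>k. (t k / \<tau> k) *\<^sub>R (z k /\<^sub>R t k)) \<longlonglongrightarrow> 0 *\<^sub>R a"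
          by (intro tendsto_scaleR ratio that)
        then have "(\<lambda>k. z k /\<^sub>R \<tau> k) \<longlonglongrightarrow> 0" unfolding cancel by simp
        then show ?thesis by (rule LIMSEQ_ignore_initial_segment)
      qed
      have "\<exists>v \<in> sphere 0 1 \<inter> graphical_derivative \<phi> xbar 0 \<inter> tangent_cone Q (\<phi> xbar).
              \<xi> \<in> dir_coderivative_image \<phi> xbar (0, v) (dir_normal_cone Q (\<phi> xbar) v)"
      proof (rule rescaled_multiplier_limit[OF xbar _ rescale[OF x] _ _ rescale[OF q]
            LIMSEQ_ignore_initial_segment[OF \<xi>s]])
        have "\<tau> \<longlonglongrightarrow> 0" using tendsto_norm[OF w_lim] by (simp add: \<tau>_def)
        then show "seq_down_zero (\<lambda>k. \<tau> (k + N))"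
          using \<tau>_pos by (auto simp: seq_down_zero_def intro: LIMSEQ_ignore_initial_segment)
        show "(\<phi> (xs (k + N)) - \<phi> xbar) /\<^sub>R \<tau> (k + N) \<in> sphere 0 1" for k
          using \<tau>_pos[of k] by (simp add: \<tau>_def w_def)
        show "bounded (range (\<lambda>k. \<eta>s (k + N)))" by (rule bounded_subset[OF \<eta>s]) auto
      qed (use graph target in auto)
      then show ?thesis by blast
    qed
    moreover have "\<xi> \<in> ?A" if calm: "calm_dir \<phi> xbar h"
    proof -
      \<comment> \<open>The points \<open>xs k\<close> also approach \<open>xbar\<close> in direction \<open>h\<close>, so calmness applies to them.\<close>
      obtain \<kappa> U where \<kappa>: "\<kappa> > 0" "dir_nbhd h U"
        "\<forall>x \<in> (+) xbar ` U. norm (\<phi> x - \<phi> xbar) \<le> \<kappa> * norm (x - xbar)"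
        using calm unfolding calm_dir_def by blast
      obtain W where W: "W \<subseteq> U"
        "\<forall>\<^sub>F k in sequentially. t k *\<^sub>R ((xs k - xbar) /\<^sub>R t k) \<in> W"
        by (rule dir_nbhd_open_core[OF \<kappa>(2)]) (use that t x in blast)
      have "\<forall>\<^sub>F k in sequentially. norm ((xs k - xbar) /\<^sub>R t k) < norm h + 1"
        using order_tendstoD(2)[OF tendsto_norm[OF x], of "norm h + 1"] by simp
      with W(2) have "\<forall>\<^sub>F k in sequentially. norm (w k) \<le> \<kappa> * (norm h + 1) * t k"
      proof eventually_elim
        case (elim k)
        have "xs k - xbar \<in> U" using elim(1) W(1) t_pos[of k] by auto
        then have "xs k \<in> (+) xbar ` U" by (rule rev_image_eqI) simp
        with \<kappa>(3) have "norm (w k) \<le> \<kappa> * norm (xs k - xbar)" unfolding w_def by blast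
        also have "\<dots> \<le> \<kappa> * ((norm h + 1) * t k)"
          using elim(2) t_pos[of k] \<kappa>(1)
          by (intro mult_left_mono) (simp_all add: norm_scaled pos_divide_less_eq del: norm_scaleR)
        finally show ?case by (simp add: mult.assoc)
      qed
      then have "infinite {k. norm (w k) \<le> \<kappa> * (norm h + 1) * t k}"
        by (simp add: eventually_frequently flip: cofinite_eq_sequentially frequently_cofinite)
      then show ?thesis by (rule bounded_case)
    qed
    ultimately show ?thesis by blast
  qed
  then show ?thesis by blast
qed

end
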